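(* For every function $f\colon\{0,1\}^n\to\mathbb{R}$ and every $S\subseteq N$, we have $$\Phi_{\mathrm{B}}(f,S)=f_S(S)-f_S(\varnothing).$$
   Context: Let $n\geqslant 1$ and $N=\{1,\ldots,n\}$. Boolean vectors $\mathbf{x}\in\{0,1\}^n$ are identified with subsets $T\subseteq N$ via $x_i=1\iff i\in T$; thus a pseudo-Boolean function $f\colon\{0,1\}^n\to\mathbb{R}$ is also regarded as a set function $f\colon 2^N\to\mathbb{R}$. For $T\subseteq N$ let $u_T(\mathbf{x})=\prod_{i\in T}x_i$ (with $u_\varnothing=1$). The Banzhaf influence index is $$\Phi_{\mathrm{B}}(f,S)=\frac{1}{2^{n-|S|}}\sum_{T\subseteq N\setminus S}\big(f(T\cup S)-f(T)\big).$$ For $S\subseteq N$ let $V_S$ be the linear span of $\{u_T:T\subseteq S\}$, i.e., the space of functions $\{0,1\}^n\to\mathbb{R}$ depending only on the variables in $S$. The best $S$-approximation of $f$ is the unique $f_S\in V_S$ minimizing $\sum_{T\subseteq N}(f(T)-g(T))^2$ among all $g\in V_S$. *)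

theory Defs
  imports "HOL-Analysis.Analysis" "HOL-Library.Function_Algebras"
begin

text \<open>
  The ground set \<open>N\<close> is the universe of a finite type \<open>'n\<close>, so that \<open>n = CARD('n) \<ge> 1\<close>. A Boolean
  vector \<open>x\<close> is identified with the set \<open>{i. x\<^sub>i = 1}\<close>, hence \<open>x\<^sub>i\<close> becomes \<open>of_bool (i \<in> X)\<close> and
  pseudo-Boolean functions are the functions of type \<open>'n set \<Rightarrow> real\<close>.
\<close>

definition unanimity :: "'n::finite set \<Rightarrow> 'n set \<Rightarrow> real" where
  "unanimity T X = (\<Prod>i\<in>T. of_bool (i \<in> X))"

definition banzhaf_influence :: "('n::finite set \<Rightarrow> real) \<Rightarrow> 'n set \<Rightarrow> real" where
  "banzhaf_influence f S =
     1 / 2 ^ (CARD('n) - card S) * (\<Sum>T | T \<subseteq> UNIV - S. f (T \<union> S) - f T)"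

definition fun_scale :: "real \<Rightarrow> ('a \<Rightarrow> real) \<Rightarrow> 'a \<Rightarrow> real" where
  "fun_scale c g = (\<lambda>x. c * g x)"

lemma vector_space_fun_scale: "vector_space fun_scale"
  by standard (auto simp: fun_scale_def fun_eq_iff algebra_simps)

text \<open>Functions carry no \<open>real_vector\<close> instance, so the span is taken with respect to the pointwise
  scaling \<^const>\<open>fun_scale\<close>.\<close>

definition approx_space :: "'n::finite set \<Rightarrow> ('n set \<Rightarrow> real) set" where
  "approx_space S = module.span fun_scale {unanimity T | T. T \<subseteq> S}"

definition is_best_approx ::
    "('n::finite set \<Rightarrow> real) \<Rightarrow> 'n set \<Rightarrow> ('n set \<Rightarrow> real) \<Rightarrow> bool" where
  "is_best_approx f S g \<longleftrightarrow>
     is_arg_min (\<lambda>h. \<Sum>T\<in>UNIV. (f T - h T)\<^sup>2) (\<lambda>h. h \<in> approx_space S) g"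

definition best_approx :: "('n::finite set \<Rightarrow> real) \<Rightarrow> 'n set \<Rightarrow> 'n set \<Rightarrow> real" where
  "best_approx f S = (THE g. is_best_approx f S g)"

lemma ex1_best_approx:
  fixes f :: "'n::finite set \<Rightarrow> real"
  shows "\<exists>!g. is_best_approx f S g"
proof -
  interpret fs: vector_space "fun_scale :: real \<Rightarrow> ('n set \<Rightarrow> real) \<Rightarrow> _"
    by (rule vector_space_fun_scale)
  define vec where "vec g = (\<chi> X. g X)" for g :: "'n set \<Rightarrow> real"
  define W where "W = vec ` approx_space S"
  have vec_inj: "vec g = vec h \<longleftrightarrow> g = h" for g h
    by (auto simp: vec_def vec_eq_iff fun_eq_iff)
  have dist_vec: "dist (vec g) (vec h) = sqrt (\<Sum>X\<in>UNIV. (g X - h X)\<^sup>2)" for g h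
    by (simp add: dist_vec_def L2_set_def vec_def dist_real_def)
  have sub: "fs.subspace (approx_space S)"
    unfolding approx_space_def by (rule fs.subspace_span)
  have "subspace W"
    unfolding subspace_def
  proof (intro conjI ballI allI)
    have "vec 0 = 0" by (simp add: vec_def vec_eq_iff)
    then show "0 \<in> W" using fs.subspace_0[OF sub] unfolding W_def by force
  next
    fix x y assume "x \<in> W" "y \<in> W"
    then obtain g h where gh: "g \<in> approx_space S" "h \<in> approx_space S" "x = vec g" "y = vec h"
      by (auto simp: W_def)
    have "x + y = vec (g + h)" by (simp add: gh vec_def vec_eq_iff)
    then show "x + y \<in> W" using fs.subspace_add[OF sub gh(1,2)] by (auto simp: W_def)
  next
    fix c x assume "x \<in> W"
    then obtain g where g: "g \<in> approx_space S" "x = vec g"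
      by (auto simp: W_def)
    have "c *\<^sub>R x = vec (fun_scale c g)" by (simp add: g vec_def vec_eq_iff fun_scale_def)
    then show "c *\<^sub>R x \<in> W" using fs.subspace_scale[OF sub g(1)] by (auto simp: W_def)
  qed
  then have W: "closed W" "convex W" "W \<noteq> {}"
    by (auto simp: closed_subspace subspace_imp_convex dest: subspace_0)
  have iff: "is_best_approx f S g \<longleftrightarrow>
      vec g \<in> W \<and> (\<forall>y\<in>W. dist (vec f) (vec g) \<le> dist (vec f) y)" for g
    by (auto simp: is_best_approx_def is_arg_min_linorder W_def dist_vec vec_inj image_iff)
  obtain w where "w \<in> W" "\<forall>y\<in>W. dist (vec f) w \<le> dist (vec f) y"
    using closest_point_exists[OF W(1,3), of "vec f"] by blast
  then have "\<exists>g. is_best_approx f S g" unfolding iff by (auto simp: W_def)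
  moreover have "g = h" if "is_best_approx f S g" "is_best_approx f S h" for g h
    using any_closest_point_unique[OF W(2,1), of "vec g" "vec h" "vec f"] that vec_inj
    unfolding iff by blast
  ultimately show ?thesis by blast
qed

end

theory Submission
  imports Defs
begin

text \<open>
  The residual \<open>f - f\<^sub>S\<close> is orthogonal to \<open>V\<^sub>S\<close>, in particular to the indicator of the cube face
  \<open>{X. X \<inter> S = R}\<close> for each \<open>R \<subseteq> S\<close>, which belongs to \<open>V\<^sub>S\<close> since it is
  \<open>\<Prod>\<^bsub>i\<in>R\<^esub> x\<^sub>i \<Prod>\<^bsub>i\<in>S-R\<^esub> (1 - x\<^sub>i)\<close>. As \<open>f\<^sub>S\<close> is constant on that face, \<open>f\<^sub>S(R)\<close> is the mean of \<open>f\<close>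
  over it. The Banzhaf index is the difference of the means over the faces for \<open>R = S\<close> and
  \<open>R = \<emptyset>\<close>.
\<close>

interpretation fun_vs: vector_space "fun_scale :: real \<Rightarrow> ('a \<Rightarrow> real) \<Rightarrow> 'a \<Rightarrow> real"
  by (rule vector_space_fun_scale)

lemma unanimity_eq: "unanimity T X = of_bool (T \<subseteq> X)"
proof (cases "T \<subseteq> X")
  case True
  then show ?thesis by (auto simp: unanimity_def intro!: prod.neutral)
next
  case False
  then show ?thesis by (auto simp: unanimity_def)
qed

lemma sum_fun_apply: "(\<Sum>i\<in>I. F i) x = (\<Sum>i\<in>I. F i x :: 'a :: comm_monoid_add)"
  by (induction I rule: infinite_finite_induct) auto

lemma approx_space_depends:
  assumes "h \<in> approx_space S"
  shows "h X = h (X \<inter> S)"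
  using assms unfolding approx_space_def
proof (induction rule: fun_vs.span_induct_alt)
  case base
  then show ?case by simp
next
  case (step c x y)
  then show ?case by (auto simp: fun_scale_def unanimity_eq)
qed

lemma face_indicator_in_approx_space:
  assumes "R \<subseteq> S"
  shows "(\<lambda>X. of_bool (X \<inter> S = R)) \<in> approx_space S"
proof -
  \<comment> \<open>The signs come from expanding the product of \<open>1 - x_i\<close> over
    \<open>S - R\<close>: \<open>T\<close> collects the indices at which the term
    \<open>- x_i\<close> is chosen.\<close>
  have "of_bool (X \<inter> S = R) =
      (\<Sum>T\<in>Pow (S - R). fun_scale ((-1) ^ card T) (unanimity (R \<union> T))) X" for X
  proof -
    have "(of_bool (X \<inter> S = R) :: real) = of_bool (R \<subseteq> X) * of_bool (\<forall>i\<in>S - R. i \<notin> X)"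
      using assms by auto
    also have "of_bool (\<forall>i\<in>S - R. i \<notin> X) = (\<Prod>i\<in>S - R. - of_bool (i \<in> X) + (1::real))"
    proof (cases "\<forall>i\<in>S - R. i \<notin> X")
      case False
      then have "(\<Prod>i\<in>S - R. - of_bool (i \<in> X) + (1::real)) = 0"
        by (intro prod_zero) auto
      with False show ?thesis by simp
    qed simp
    also have "\<dots> = (\<Sum>T\<in>Pow (S - R). (-1) ^ card T * unanimity T X)"
      by (subst prod_add) (simp_all add: unanimity_def prod_uminus)
    finally show ?thesis
      by (simp add: sum_distrib_left sum_fun_apply fun_scale_def unanimity_eq)
  qed
  then have "(\<lambda>X. of_bool (X \<inter> S = R)) =
      (\<Sum>T\<in>Pow (S - R). fun_scale ((-1) ^ card T) (unanimity (R \<union> T)))"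
    by (rule ext)
  also have "\<dots> \<in> approx_space S"
    unfolding approx_space_def using assms
    by (intro fun_vs.span_sum fun_vs.span_scale fun_vs.span_base) auto
  finally show ?thesis .
qed

text \<open>Moving from \<open>g\<close> along \<open>h\<close> stays in
  \<open>approx_space S\<close>, so no step may lower the squared error.\<close>

lemma best_approx_orthogonal:
  assumes g: "is_best_approx f S g" and h: "h \<in> approx_space S"
  shows "(\<Sum>X\<in>UNIV. (f X - g X) * h X) = 0"
proof -
  define p where "p = (\<Sum>X\<in>UNIV. (f X - g X) * h X)"
  define q where "q = (\<Sum>X\<in>UNIV. (h X)\<^sup>2)"
  have q: "q \<ge> 0" by (simp add: q_def sum_nonneg)
  \<comment> \<open>Any step size strictly between \<open>0\<close> and \<open>2 * p / q\<close> would decrease the error if \<open>p \<noteq> 0\<close>;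
      adding \<open>1\<close> to the optimal denominator covers \<open>q = 0\<close>.\<close>
  define t where "t = p / (q + 1)"
  have "g + fun_scale t h \<in> approx_space S"
    using g h unfolding is_best_approx_def is_arg_min_linorder approx_space_def
    by (blast intro: fun_vs.span_add fun_vs.span_scale)
  then have "(\<Sum>X\<in>UNIV. (f X - g X)\<^sup>2) \<le> (\<Sum>X\<in>UNIV. (f X - (g X + t * h X))\<^sup>2)"
    using g by (fastforce simp: is_best_approx_def is_arg_min_linorder fun_scale_def)
  also have "\<dots> = (\<Sum>X\<in>UNIV. (f X - g X)\<^sup>2 - 2 * t * ((f X - g X) * h X) + t\<^sup>2 * (h X)\<^sup>2)"
    by (intro sum.cong refl) (simp add: power2_eq_square algebra_simps)
  also have "\<dots> = (\<Sum>X\<in>UNIV. (f X - g X)\<^sup>2) - 2 * t * p + t\<^sup>2 * q"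
    by (simp add: sum.distrib sum_subtractf p_def q_def sum_distrib_left)
  finally have "0 \<le> t\<^sup>2 * q - 2 * t * p" by simp
  \<comment> \<open>Eliminating \<open>p\<close> leaves \<open>- t^2 * (q + 2)\<close> on the right,
    which is negative unless \<open>t = 0\<close>.\<close>
  also have "p = t * (q + 1)" using q by (simp add: t_def)
  finally have "t\<^sup>2 * (q + 2) \<le> 0" by (simp add: power2_eq_square algebra_simps)
  with q have "t = 0" by (simp add: mult_le_0_iff)
  with q show ?thesis by (simp add: t_def p_def)
qed

lemma best_approx_eq_mean:
  fixes f :: "'n::finite set \<Rightarrow> real"
  assumes "R \<subseteq> S"
  shows "best_approx f S R =
    1 / 2 ^ (CARD('n) - card S) * (\<Sum>T | T \<subseteq> UNIV - S. f (T \<union> R))"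
proof -
  let ?g = "best_approx f S"
  have g: "is_best_approx f S ?g"
    unfolding best_approx_def by (rule theI'[OF ex1_best_approx])
  have const: "?g (T \<union> R) = ?g R" if "T \<subseteq> UNIV - S" for T
  proof -
    have "(T \<union> R) \<inter> S = R" using that assms by auto
    then show ?thesis
      using approx_space_depends[of ?g S "T \<union> R"] g
      by (simp add: is_best_approx_def is_arg_min_linorder)
  qed
  \<comment> \<open>On the face the coordinates in \<open>S\<close> are frozen to \<open>R\<close>,
    and \<open>T\<close> records the free ones.\<close>
  have "bij_betw (\<lambda>T. T \<union> R) {T. T \<subseteq> UNIV - S} {X. X \<inter> S = R}"
    by (rule bij_betwI[where g = "\<lambda>X. X - S"]) (use assms in auto)
  then have "(\<Sum>T | T \<subseteq> UNIV - S. f (T \<union> R) - ?g (T \<union> R)) = (\<Sum>X | X \<inter> S = R. f X - ?g X)"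
    by (rule sum.reindex_bij_betw)
  also have "\<dots> = (\<Sum>X\<in>UNIV. (f X - ?g X) * of_bool (X \<inter> S = R))"
    by (intro sum.mono_neutral_cong_left) auto
  also have "\<dots> = 0"
    by (rule best_approx_orthogonal[OF g face_indicator_in_approx_space[OF assms]])
  finally have "(\<Sum>T | T \<subseteq> UNIV - S. f (T \<union> R)) = (\<Sum>T | T \<subseteq> UNIV - S. ?g R)"
    using const by (simp add: sum_subtractf)
  also have "\<dots> = 2 ^ (CARD('n) - card S) * ?g R"
    by (simp add: Pow_def[symmetric] card_Pow card_Diff_subset)
  finally show ?thesis by simp
qed

theorem proposition2p6:
  fixes f :: "'n::finite set \<Rightarrow> real" and S :: "'n set"
  shows "banzhaf_influence f S = best_approx f S S - best_approx f S {}"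
  by (simp add: banzhaf_influence_def best_approx_eq_mean sum_subtractf right_diff_distrib
      diff_divide_distrib)

end
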